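(* Let $H$ be a homogeneous relation on a finite set $X$. Then $H$ is the standard homogeneous relation of some undirected graph on $X$ if and only if $H$ is graphic; and $H$ is the standard homogeneous relation of some tournament on $X$ if and only if $H$ is tournamental.
   Context: A diverse triple of $X$ is $(x,y,z)\in X^3$ with $x\neq y$, $x\neq z$, written $(x|yz)$. A homogeneous relation $H$ on $X$ is a relation on diverse triples such that for every $x\in X$ the relation $H_x(y,z)\Leftrightarrow H(x|yz)$ is an equivalence relation on $X\setminus\{x\}$. For $A\subseteq X$, $H[A]$ is the restriction of $H$ to diverse triples in $A^3$. The congruence of $x$ (w.r.t. $H$) is the number of equivalence classes of $H_x$; the local congruence of $H$ is the maximum congruence over $x\in X$. $H$ is graphic if its local congruence is at most $2$ and for every 3-element subset $\{a,b,c\}\subseteq X$, $H[\{a,b,c\}]$ has exactly $0$ or $2$ elements of congruence $2$. $H$ is tournamental if its local congruence is at most $2$ and for every 3-element subset $\{a,b,c\}$, $H[\{a,b,c\}]$ has exactly $1$ or $3$ elements of congruence $2$. The standard homogeneous relation $H(G)$ of a (directed) graph $G$ on $X$ is defined by: $H(G)(x|uv)$ holds iff either both or none of $u,v$ are in-neighbours of $x$, and either both or none of $u,v$ are out-neighbours of $x$ (for an undirected graph: both or none of $u,v$ are neighbours of $x$). *)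

theory Defs
  imports "Graph_Theory.Pair_Digraph"
begin

text \<open>A triple \<open>(x|yz)\<close> is encoded as \<open>(x, y, z)\<close>; \<open>y = z\<close> is allowed. A homogeneous relation is
  the set of the diverse triples on which it holds, so that equality of relations is equality of sets.\<close>

definition diverse_triples :: "'a set \<Rightarrow> ('a \<times> 'a \<times> 'a) set" where
  "diverse_triples X = {(x, y, z). x \<in> X \<and> y \<in> X \<and> z \<in> X \<and> x \<noteq> y \<and> x \<noteq> z}"

definition rel_at :: "('a \<times> 'a \<times> 'a) set \<Rightarrow> 'a \<Rightarrow> 'a rel" where
  "rel_at H x = {(y, z). (x, y, z) \<in> H}"

definition homogeneous :: "'a set \<Rightarrow> ('a \<times> 'a \<times> 'a) set \<Rightarrow> bool" where
  "homogeneous X H \<longleftrightarrow>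
     H \<subseteq> diverse_triples X \<and> (\<forall>x\<in>X. equiv (X - {x}) (rel_at H x))"

definition restrict_rel :: "('a \<times> 'a \<times> 'a) set \<Rightarrow> 'a set \<Rightarrow> ('a \<times> 'a \<times> 'a) set" where
  "restrict_rel H A = H \<inter> diverse_triples A"

definition congruence :: "'a set \<Rightarrow> ('a \<times> 'a \<times> 'a) set \<Rightarrow> 'a \<Rightarrow> nat" where
  "congruence X H x = card ((X - {x}) // rel_at H x)"

text \<open>On \<^typ>\<open>nat\<close>, the supremum of a finite nonempty set is its maximum, and that of the empty set is \<open>0\<close>.\<close>

definition local_congruence :: "'a set \<Rightarrow> ('a \<times> 'a \<times> 'a) set \<Rightarrow> nat" where
  "local_congruence X H = (SUP x\<in>X. congruence X H x)"

definition num_congruence_two :: "('a \<times> 'a \<times> 'a) set \<Rightarrow> 'a set \<Rightarrow> nat" where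
  "num_congruence_two H A = card {x \<in> A. congruence A (restrict_rel H A) x = 2}"

definition graphic :: "'a set \<Rightarrow> ('a \<times> 'a \<times> 'a) set \<Rightarrow> bool" where
  "graphic X H \<longleftrightarrow> local_congruence X H \<le> 2 \<and>
     (\<forall>A \<subseteq> X. card A = 3 \<longrightarrow> num_congruence_two H A \<in> {0, 2})"

definition tournamental :: "'a set \<Rightarrow> ('a \<times> 'a \<times> 'a) set \<Rightarrow> bool" where
  "tournamental X H \<longleftrightarrow> local_congruence X H \<le> 2 \<and>
     (\<forall>A \<subseteq> X. card A = 3 \<longrightarrow> num_congruence_two H A \<in> {1, 3})"

definition standard_rel :: "'a pair_pre_digraph \<Rightarrow> ('a \<times> 'a \<times> 'a) set" where
  "standard_rel G = {(x, u, v) \<in> diverse_triples (pverts G).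
     ((u, x) \<in> parcs G \<longleftrightarrow> (v, x) \<in> parcs G) \<and>
     ((x, u) \<in> parcs G \<longleftrightarrow> (x, v) \<in> parcs G)}"

text \<open>An undirected graph (\<^locale>\<open>pair_graph\<close>) is a finite loop-free symmetric digraph. For it,
  \<^const>\<open>standard_rel\<close> is the relation ``both or none of \<open>u\<close>, \<open>v\<close> are neighbours of \<open>x\<close>''.\<close>

lemma (in pair_graph) standard_rel_undirected:
  "standard_rel G = {(x, u, v) \<in> diverse_triples (pverts G).
     (x, u) \<in> parcs G \<longleftrightarrow> (x, v) \<in> parcs G}"
proof -
  have "sym (parcs G)"
    using pair_sym_arcs by (simp add: symmetric_def)
  then have "(u, v) \<in> parcs G \<longleftrightarrow> (v, u) \<in> parcs G" for u v
    by (auto dest: symD)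
  then show ?thesis
    unfolding standard_rel_def by auto
qed

lemma homogeneous_standard_rel: "homogeneous (pverts G) (standard_rel G)"
  unfolding homogeneous_def equiv_def
  by (auto simp: standard_rel_def diverse_triples_def rel_at_def refl_on_def sym_def trans_def)

locale tournament = pair_digraph +
  assumes tournament_arcs:
    "\<lbrakk>u \<in> pverts G; v \<in> pverts G; u \<noteq> v\<rbrakk> \<Longrightarrow> (u, v) \<in> parcs G \<longleftrightarrow> (v, u) \<notin> parcs G"

end

theory Submission
  imports Defs
begin

text \<open>If every \<open>H\<^sub>x\<close> has at most two classes, choose a two-colouring \<open>c\<^sub>x\<close> of \<open>X - {x}\<close> inducing it. A graph
  (or tournament) realising \<open>H\<close> amounts to bits \<open>f\<^sub>x\<close>, telling which class of \<open>H\<^sub>x\<close> is the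
  (out-)neighbourhood of \<open>x\<close>, such that \<open>c\<^sub>x(y) + f\<^sub>x = c\<^sub>y(x) + f\<^sub>y + p\<close> modulo 2, with \<open>p = 0\<close> for
  graphs and \<open>p = 1\<close> for tournaments. So \<open>c\<^sub>x(y) + c\<^sub>y(x) + p\<close> has to be the coboundary of \<open>f\<close> over the
  two-element field, on a complete graph, which holds iff it sums to 0 on every triangle; and its sum
  on a triangle is \<open>p\<close> plus the number of vertices of congruence 2.\<close>

section \<open>Two-colourings from equivalence relations with few classes\<close>

text \<open>Membership in one fixed class serves as the colouring; conversely, each class is a fibre
  of \<open>c\<close>, and \<open>bool\<close> has two values.\<close>

lemma card_quotient_le_two_iff:
  assumes "finite A" "equiv A r"
  shows "card (A // r) \<le> 2 \<longleftrightarrow> (\<exists>c :: 'a \<Rightarrow> bool. \<forall>y\<in>A. \<forall>z\<in>A. (y, z) \<in> r \<longleftrightarrow> c y = c z)"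
proof
  assume le: "card (A // r) \<le> 2"
  have fin: "finite (A // r)"
    using assms by (auto simp: equiv_def intro: finite_quotient)
  obtain P Q where PQ: "A // r \<subseteq> {P, Q}"
  proof -
    consider "card (A // r) = 0" | "card (A // r) = 1" | "card (A // r) = 2"
      using le by linarith
    then show thesis
      using that fin by cases (auto simp: card_1_singleton_iff card_2_iff)
  qed
  \<comment> \<open>\<open>P\<close> and \<open>Q\<close> need not be distinct or be classes. Two
    elements whose classes both differ from \<open>P\<close> share the class
    \<open>Q\<close>.\<close>
  have "(y, z) \<in> r \<longleftrightarrow> (r `` {y} = P) = (r `` {z} = P)" if "y \<in> A" "z \<in> A" for y z
    using PQ quotientI[OF that(1), of r] quotientI[OF that(2), of r]
      eq_equiv_class_iff[OF assms(2) that] by blast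
  then show "\<exists>c :: 'a \<Rightarrow> bool. \<forall>y\<in>A. \<forall>z\<in>A. (y, z) \<in> r \<longleftrightarrow> c y = c z"
    by (intro exI[of _ "\<lambda>y. r `` {y} = P"] ballI) simp
next
  assume "\<exists>c :: 'a \<Rightarrow> bool. \<forall>y\<in>A. \<forall>z\<in>A. (y, z) \<in> r \<longleftrightarrow> c y = c z"
  then obtain c :: "'a \<Rightarrow> bool" where c: "\<And>y z. y \<in> A \<Longrightarrow> z \<in> A \<Longrightarrow> (y, z) \<in> r \<longleftrightarrow> c y = c z"
    by blast
  have "r `` {y} = {z \<in> A. c z = c y}" if "y \<in> A" for y
    using that c assms(2) by (auto simp: equiv_def)
  then have "A // r \<subseteq> (\<lambda>b. {z \<in> A. c z = b}) ` UNIV"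
    by (auto simp: quotient_def)
  then have "card (A // r) \<le> card (UNIV :: bool set)"
    by (rule surj_card_le[rotated]) simp
  then show "card (A // r) \<le> 2"
    by simp
qed

lemma local_congruence_le_iff:
  assumes "finite X"
  shows "local_congruence X H \<le> k \<longleftrightarrow> (\<forall>x\<in>X. congruence X H x \<le> k)"
\<comment> \<open>\<open>cSUP_le_iff\<close> needs a nonempty index set; the supremum of the empty
  set of naturals is 0.\<close>
proof (cases "X = {}")
  case True
  then show ?thesis
    by (simp add: local_congruence_def)
next
  case False
  then show ?thesis
    using assms by (simp add: local_congruence_def cSUP_le_iff)
qed

text \<open>Choice bundles the colourings of the sets \<open>X - {x}\<close> into one function
  \<open>c\<close>, whose diagonal values \<open>c x x\<close> stay arbitrary.\<close>

lemma local_congruence_le_two_iff: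
  assumes "finite X" "homogeneous X H"
  shows "local_congruence X H \<le> 2 \<longleftrightarrow>
    (\<exists>c :: 'a \<Rightarrow> 'a \<Rightarrow> bool. \<forall>x y z. (x, y, z) \<in> diverse_triples X \<longrightarrow>
      ((x, y, z) \<in> H \<longleftrightarrow> c x y = c x z))"
proof -
  have "congruence X H x \<le> 2 \<longleftrightarrow>
      (\<exists>c :: 'a \<Rightarrow> bool. \<forall>y\<in>X - {x}. \<forall>z\<in>X - {x}. (x, y, z) \<in> H \<longleftrightarrow> c y = c z)"
    if "x \<in> X" for x
    using card_quotient_le_two_iff[of "X - {x}" "rel_at H x"] assms that
    by (simp add: congruence_def homogeneous_def rel_at_def)
  then have "local_congruence X H \<le> 2 \<longleftrightarrow>
      (\<exists>c :: 'a \<Rightarrow> 'a \<Rightarrow> bool. \<forall>x\<in>X. \<forall>y\<in>X - {x}. \<forall>z\<in>X - {x}. (x, y, z) \<in> H \<longleftrightarrow> c x y = c x z)"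
    by (simp add: local_congruence_le_iff[OF assms(1)] bchoice_iff)
  moreover have "(\<forall>x\<in>X. \<forall>y\<in>X - {x}. \<forall>z\<in>X - {x}. (x, y, z) \<in> H \<longleftrightarrow> c x y = c x z) \<longleftrightarrow>
      (\<forall>x y z. (x, y, z) \<in> diverse_triples X \<longrightarrow> ((x, y, z) \<in> H \<longleftrightarrow> c x y = c x z))"
    for c :: "'a \<Rightarrow> 'a \<Rightarrow> bool"
    by (auto simp: diverse_triples_def)
  ultimately show ?thesis
    by simp
qed

section \<open>Congruences on three-element subsets\<close>

lemma homogeneous_restrict_rel:
  assumes "homogeneous X H" "A \<subseteq> X"
  shows "homogeneous A (restrict_rel H A)"
proof -
  have "equiv (A - {x}) (rel_at (restrict_rel H A) x)" if "x \<in> A" for x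
  proof -
    have "rel_at (restrict_rel H A) x = rel_at H x \<inter> (A - {x}) \<times> (A - {x})"
      using that by (auto simp: rel_at_def restrict_rel_def diverse_triples_def)
    moreover have "refl_on (X - {x}) (rel_at H x)" "sym (rel_at H x)" "trans (rel_at H x)"
      using assms that by (auto simp: homogeneous_def equiv_def)
    ultimately show ?thesis
      using assms(2) by (auto simp: equiv_def refl_on_def intro: sym_Int symI transI dest: symD transD)
  qed
  then show ?thesis
    by (auto simp: homogeneous_def restrict_rel_def)
qed

text \<open>Only \<open>b\<close> and \<open>c\<close> remain beside \<open>a\<close>, so the
  quotient consists of their two classes, which differ unless \<open>b\<close> and \<open>c\<close>
  are related.\<close>

lemma congruence_triple_eq_two_iff:
  assumes "homogeneous X H" "{a, b, c} \<subseteq> X" "distinct [a, b, c]"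
  shows "congruence {a, b, c} (restrict_rel H {a, b, c}) a = 2 \<longleftrightarrow> (a, b, c) \<notin> H"
proof -
  let ?r = "rel_at (restrict_rel H {a, b, c}) a"
  have diff: "{a, b, c} - {a} = {b, c}"
    using assms(3) by auto
  have "equiv {b, c} ?r"
    using homogeneous_restrict_rel[OF assms(1,2)] diff by (auto simp: homogeneous_def)
  then have "?r `` {b} = ?r `` {c} \<longleftrightarrow> (b, c) \<in> ?r"
    by (rule eq_equiv_class_iff) auto
  moreover have "(b, c) \<in> ?r \<longleftrightarrow> (a, b, c) \<in> H"
    using assms(3) by (auto simp: rel_at_def restrict_rel_def diverse_triples_def)
  moreover have "{b, c} // ?r = {?r `` {b}, ?r `` {c}}"
    by (auto simp: quotient_def)
  ultimately show ?thesis
    by (simp add: congruence_def diff card_insert_if)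
qed

lemma num_congruence_two_triple:
  assumes "homogeneous X H" "{a, b, c} \<subseteq> X" "distinct [a, b, c]"
  shows "num_congruence_two H {a, b, c} =
    of_bool ((a, b, c) \<notin> H) + of_bool ((b, a, c) \<notin> H) + of_bool ((c, a, b) \<notin> H)"
proof -
  let ?P = "\<lambda>x. congruence {a, b, c} (restrict_rel H {a, b, c}) x = 2"
  have "num_congruence_two H {a, b, c} = (\<Sum>x\<in>{a, b, c}. of_bool (?P x))"
    by (simp add: num_congruence_two_def Int_def del: insert_iff)
  also have "\<dots> = of_bool (?P a) + of_bool (?P b) + of_bool (?P c)"
    using assms(3) by simp
  finally have "num_congruence_two H {a, b, c} = of_bool (?P a) + of_bool (?P b) + of_bool (?P c)" .
  \<comment> \<open>The preceding lemma treats the vertex listed first, so the set is reordered to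
    reach \<open>b\<close> and \<open>c\<close>.\<close>
  moreover have "{b, a, c} = {a, b, c}" "{c, a, b} = {a, b, c}"
    by auto
  then have "?P a \<longleftrightarrow> (a, b, c) \<notin> H" "?P b \<longleftrightarrow> (b, a, c) \<notin> H" "?P c \<longleftrightarrow> (c, a, b) \<notin> H"
    using congruence_triple_eq_two_iff[OF assms]
      congruence_triple_eq_two_iff[OF assms(1), of b a c]
      congruence_triple_eq_two_iff[OF assms(1), of c a b] assms(2,3)
    by force+
  ultimately show ?thesis
    by simp
qed

text \<open>For Boolean values, \<open>p \<noteq> q\<close> is the sum modulo 2.\<close>

definition triple_parity :: "bool \<Rightarrow> 'a set \<Rightarrow> ('a \<times> 'a \<times> 'a) set \<Rightarrow> bool" where
  "triple_parity p X H \<longleftrightarrow> (\<forall>a\<in>X. \<forall>b\<in>X. \<forall>c\<in>X. distinct [a, b, c] \<longrightarrow>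
     ((((a, b, c) \<notin> H) \<noteq> ((b, a, c) \<notin> H)) \<noteq> ((c, a, b) \<notin> H)) = p)"

lemma ball_triple_subset_iff:
  "(\<forall>A\<subseteq>X. card A = 3 \<longrightarrow> P A) \<longleftrightarrow>
   (\<forall>a\<in>X. \<forall>b\<in>X. \<forall>c\<in>X. distinct [a, b, c] \<longrightarrow> P {a, b, c})"
proof
  assume *: "\<forall>A\<subseteq>X. card A = 3 \<longrightarrow> P A"
  show "\<forall>a\<in>X. \<forall>b\<in>X. \<forall>c\<in>X. distinct [a, b, c] \<longrightarrow> P {a, b, c}"
    by (intro ballI impI *[rule_format]) auto
next
  assume *: "\<forall>a\<in>X. \<forall>b\<in>X. \<forall>c\<in>X. distinct [a, b, c] \<longrightarrow> P {a, b, c}"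
  show "\<forall>A\<subseteq>X. card A = 3 \<longrightarrow> P A"
    using * by (auto simp: card_3_iff)
qed

text \<open>The count lies between 0 and 3, so \<open>{0, 2}\<close> and \<open>{1, 3}\<close> are
  the two parity conditions on it.\<close>

lemma num_congruence_two_iff_triple_parity:
  assumes "homogeneous X H"
  shows "(\<forall>A\<subseteq>X. card A = 3 \<longrightarrow> num_congruence_two H A \<in> {of_bool p, of_bool p + 2}) \<longleftrightarrow>
    triple_parity p X H"
proof -
  have "num_congruence_two H {a, b, c} \<in> {of_bool p, of_bool p + 2} \<longleftrightarrow>
      ((((a, b, c) \<notin> H) \<noteq> ((b, a, c) \<notin> H)) \<noteq> ((c, a, b) \<notin> H)) = p"
    if "a \<in> X" "b \<in> X" "c \<in> X" "distinct [a, b, c]" for a b c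
    using num_congruence_two_triple[OF assms, of a b c] that by (auto simp: of_bool_def)
  then show ?thesis
    unfolding ball_triple_subset_iff triple_parity_def by simp
qed

lemma graphic_iff:
  assumes "homogeneous X H"
  shows "graphic X H \<longleftrightarrow> local_congruence X H \<le> 2 \<and> triple_parity False X H"
  using num_congruence_two_iff_triple_parity[OF assms, of False]
  by (simp add: graphic_def numeral_eq_Suc)

lemma tournamental_iff:
  assumes "homogeneous X H"
  shows "tournamental X H \<longleftrightarrow> local_congruence X H \<le> 2 \<and> triple_parity True X H"
  using num_congruence_two_iff_triple_parity[OF assms, of True]
  by (simp add: tournamental_def numeral_eq_Suc)

section \<open>Graphs and tournaments as arc sets\<close>

text \<open>Covers both kinds of graph at once: \<open>p = False\<close> is symmetry,
  \<open>p = True\<close> demands exactly one arc between distinct vertices.\<close>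

definition twisted_symmetric :: "bool \<Rightarrow> 'a set \<Rightarrow> ('a \<times> 'a) set \<Rightarrow> bool" where
  "twisted_symmetric p X E \<longleftrightarrow> E \<subseteq> X \<times> X \<and> irrefl E \<and>
     (\<forall>u\<in>X. \<forall>v\<in>X. u \<noteq> v \<longrightarrow> ((u, v) \<in> E) = (((v, u) \<in> E) \<noteq> p))"

lemma finite_twisted_symmetric:
  assumes "finite X" "twisted_symmetric p X E"
  shows "finite E"
  using finite_subset[of E "X \<times> X"] assms by (simp add: twisted_symmetric_def)

lemma pair_graph_iff:
  "pair_graph G \<longleftrightarrow> finite (pverts G) \<and> twisted_symmetric False (pverts G) (parcs G)"
proof
  assume "pair_graph G"
  then interpret pair_graph G .
  have "sym (parcs G)"
    using pair_sym_arcs by (simp add: symmetric_def)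
  then show "finite (pverts G) \<and> twisted_symmetric False (pverts G) (parcs G)"
    using in_arcsD1 in_arcsD2 pair_no_loops pair_finite_verts
    by (fastforce simp: twisted_symmetric_def irrefl_def dest: symD)
next
  assume *: "finite (pverts G) \<and> twisted_symmetric False (pverts G) (parcs G)"
  then have "finite (parcs G)"
    using finite_twisted_symmetric by blast
  moreover have "sym (parcs G)"
    using * unfolding twisted_symmetric_def irrefl_def
    by (intro symI) (metis mem_Sigma_iff subsetD)
  ultimately show "pair_graph G"
    using * by unfold_locales (auto simp: twisted_symmetric_def irrefl_def symmetric_def)
qed

lemma tournament_iff:
  "tournament G \<longleftrightarrow> finite (pverts G) \<and> twisted_symmetric True (pverts G) (parcs G)"
proof
  assume "tournament G"
  then interpret tournament G .
  \<comment> \<open>\<open>tournament_arcs\<close> concerns distinct vertices only; the absence of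
    loops comes from \<open>pair_digraph\<close>.\<close>
  have "parcs G \<subseteq> pverts G \<times> pverts G" "irrefl (parcs G)"
    using in_arcsD1 in_arcsD2 pair_no_loops by (fastforce simp: irrefl_def)+
  then show "finite (pverts G) \<and> twisted_symmetric True (pverts G) (parcs G)"
    using pair_finite_verts tournament_arcs unfolding twisted_symmetric_def by blast
next
  assume *: "finite (pverts G) \<and> twisted_symmetric True (pverts G) (parcs G)"
  then have "finite (parcs G)"
    using finite_twisted_symmetric by blast
  moreover have "parcs G \<subseteq> pverts G \<times> pverts G" "irrefl (parcs G)"
    using * by (simp_all only: twisted_symmetric_def)
  ultimately have "pair_digraph G"
    using * by unfold_locales (auto simp: irrefl_def)
  then show "tournament G"
    using * unfolding tournament_def tournament_axioms_def twisted_symmetric_def by blast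
qed

section \<open>Realising a relation by an arc set\<close>

text \<open>Reversing arcs at \<open>x\<close> adds \<open>p\<close> to both sides of the
  in-neighbour condition, so it coincides with the out-neighbour condition.\<close>

lemma standard_rel_twisted_symmetric:
  assumes "twisted_symmetric p (pverts G) (parcs G)" "(x, u, v) \<in> diverse_triples (pverts G)"
  shows "(x, u, v) \<in> standard_rel G \<longleftrightarrow> ((x, u) \<in> parcs G \<longleftrightarrow> (x, v) \<in> parcs G)"
  using assms unfolding standard_rel_def twisted_symmetric_def diverse_triples_def
  by (cases p) auto

lemma ex_twisted_symmetric_iff:
  fixes X :: "'a set" and H :: "('a \<times> 'a \<times> 'a) set"
  assumes "finite X" "homogeneous X H"
  shows "(\<exists>G. twisted_symmetric p X (parcs G) \<and> pverts G = X \<and> H = standard_rel G) \<longleftrightarrow>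
    local_congruence X H \<le> 2 \<and> triple_parity p X H"
proof safe
  fix G :: "'a pair_pre_digraph"
  assume E: "twisted_symmetric p (pverts G) (parcs G)"
  note mem = standard_rel_twisted_symmetric[OF E]
  assume G: "X = pverts G" "H = standard_rel G"
  show "local_congruence (pverts G) (standard_rel G) \<le> 2"
    unfolding local_congruence_le_two_iff[OF assms[unfolded G]]
    by (intro exI[of _ "\<lambda>x y. (x, y) \<in> parcs G"]) (auto simp: mem)
  have eq: "(u, v) \<in> parcs G \<longleftrightarrow> ((v, u) \<in> parcs G) \<noteq> p"
    if "u \<in> pverts G" "v \<in> pverts G" "u \<noteq> v" for u v
    using E that unfolding twisted_symmetric_def by blast
  show "triple_parity p (pverts G) (standard_rel G)"
    unfolding triple_parity_def
  proof (intro ballI impI)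
    fix a b c
    assume abc: "a \<in> pverts G" "b \<in> pverts G" "c \<in> pverts G" "distinct [a, b, c]"
    have "(a, b, c) \<in> standard_rel G \<longleftrightarrow> ((a, b) \<in> parcs G \<longleftrightarrow> (a, c) \<in> parcs G)"
      "(b, a, c) \<in> standard_rel G \<longleftrightarrow> ((b, a) \<in> parcs G \<longleftrightarrow> (b, c) \<in> parcs G)"
      "(c, a, b) \<in> standard_rel G \<longleftrightarrow> ((c, a) \<in> parcs G \<longleftrightarrow> (c, b) \<in> parcs G)"
      using abc by (auto simp: mem diverse_triples_def)
    \<comment> \<open>The sum runs over all six arcs of the triangle; each opposite pair contributes
      \<open>p\<close>, and \<open>3p = p\<close> modulo 2.\<close>
    then show "((((a, b, c) \<notin> standard_rel G) \<noteq> ((b, a, c) \<notin> standard_rel G)) \<noteq>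
        ((c, a, b) \<notin> standard_rel G)) = p"
      using eq[of a b] eq[of a c] eq[of b c] abc by auto
  qed
next
  assume "local_congruence X H \<le> 2" and par: "triple_parity p X H"
  then obtain c :: "'a \<Rightarrow> 'a \<Rightarrow> bool"
    where c: "\<And>x y z. (x, y, z) \<in> diverse_triples X \<Longrightarrow> (x, y, z) \<in> H \<longleftrightarrow> c x y = c x z"
    unfolding local_congruence_le_two_iff[OF assms] by metis
  define d where "d x y = ((c x y \<noteq> c y x) \<noteq> p)" for x y
  \<comment> \<open>The six colour values on a triangle sum to \<open>p\<close>; the three added
    copies of \<open>p\<close> make the sum of the three values of \<open>d\<close> zero.\<close>
  have cocycle: "d x z = (d x y \<noteq> d y z)"
    if "x \<in> X" "y \<in> X" "z \<in> X" "distinct [x, y, z]" for x y z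
  proof -
    have "((((x, y, z) \<notin> H) \<noteq> ((y, x, z) \<notin> H)) \<noteq> ((z, x, y) \<notin> H)) = p"
      using par that unfolding triple_parity_def by blast
    moreover have "(x, y, z) \<in> H \<longleftrightarrow> c x y = c x z" "(y, x, z) \<in> H \<longleftrightarrow> c y x = c y z"
      "(z, x, y) \<in> H \<longleftrightarrow> c z x = c z y"
      using that by (auto intro!: c simp: diverse_triples_def)
    ultimately show ?thesis
      unfolding d_def by auto
  qed
  obtain f :: "'a \<Rightarrow> bool"
    where f: "\<And>x y. x \<in> X \<Longrightarrow> y \<in> X \<Longrightarrow> x \<noteq> y \<Longrightarrow> d x y = (f x \<noteq> f y)"
  proof (cases "X = {}")
    case False
    then obtain w where w: "w \<in> X"
      by blast
    have comm: "d x y = d y x" for x y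
      unfolding d_def by auto
    \<comment> \<open>The potential is \<open>f x = d w x\<close>, based at \<open>w\<close>. The
      guard forces \<open>f w = False\<close>, as \<open>d w w\<close> equals \<open>p\<close>,
      which may be \<open>True\<close>.\<close>
    have "d x y = ((x \<noteq> w \<and> d w x) \<noteq> (y \<noteq> w \<and> d w y))"
      if "x \<in> X" "y \<in> X" "x \<noteq> y" for x y
      using cocycle[of x w y] comm[of x w] that w by auto
    then show thesis
      by (rule that)
  qed (use that in blast)
  \<comment> \<open>Adding \<open>f x\<close> at most swaps the two colours at \<open>x\<close>, so
    it preserves which vertices share a colour; the equation for \<open>f\<close> is what makes
    \<open>E\<close> twisted symmetric.\<close>
  define E where "E = {(x, y). x \<in> X \<and> y \<in> X \<and> x \<noteq> y \<and> c x y \<noteq> f x}"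
  define G where "G = \<lparr>pverts = X, parcs = E\<rparr>"
  have E: "twisted_symmetric p (pverts G) (parcs G)"
    unfolding twisted_symmetric_def
  proof (intro conjI ballI impI)
    fix u v
    assume "u \<in> pverts G" "v \<in> pverts G" "u \<noteq> v"
    then show "((u, v) \<in> parcs G) = (((v, u) \<in> parcs G) \<noteq> p)"
      using f[of u v] by (auto simp: G_def E_def d_def)
  qed (auto simp: G_def E_def irrefl_def)
  have "t \<in> H \<longleftrightarrow> t \<in> standard_rel G" for t
  proof (cases "t \<in> diverse_triples X")
    case True
    obtain x u v where t: "t = (x, u, v)"
      by (rule prod_cases3)
    have "(x, u, v) \<in> standard_rel G \<longleftrightarrow> ((x, u) \<in> E \<longleftrightarrow> (x, v) \<in> E)"
      using standard_rel_twisted_symmetric[OF E, of x u v] True t by (simp add: G_def)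
    also have "\<dots> \<longleftrightarrow> c x u = c x v"
      using True unfolding t E_def diverse_triples_def by auto
    finally show ?thesis
      using c[of x u v] True t by simp
  next
    case False
    then show ?thesis
      using assms(2) by (auto simp: homogeneous_def standard_rel_def G_def)
  qed
  then show "\<exists>G. twisted_symmetric p X (parcs G) \<and> pverts G = X \<and> H = standard_rel G"
    using E by (intro exI[of _ G]) (auto simp: G_def)
qed

theorem theorem3:
  fixes X :: "'a set" and H :: "('a \<times> 'a \<times> 'a) set"
  assumes "finite X"
    and "homogeneous X H"
  shows "((\<exists>G. pair_graph G \<and> pverts G = X \<and> H = standard_rel G) \<longleftrightarrow> graphic X H) \<and>
         ((\<exists>G. tournament G \<and> pverts G = X \<and> H = standard_rel G) \<longleftrightarrow> tournamental X H)"
proof -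
  \<comment> \<open>Keeping \<open>pverts G = X\<close> on both sides lets the finiteness of
    \<open>X\<close> discharge that of the vertex set.\<close>
  have "pair_graph G \<and> pverts G = X \<longleftrightarrow> twisted_symmetric False X (parcs G) \<and> pverts G = X"
    "tournament G \<and> pverts G = X \<longleftrightarrow> twisted_symmetric True X (parcs G) \<and> pverts G = X"
    for G :: "'a pair_pre_digraph"
    using pair_graph_iff[of G] tournament_iff[of G] assms(1) by metis+
  then show ?thesis
    unfolding graphic_iff[OF assms(2)] tournamental_iff[OF assms(2)]
      ex_twisted_symmetric_iff[OF assms, symmetric] by (metis (no_types, lifting))
qed

end
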